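(* There exist constants $C>0$ and $x_0$ such that for all real $x\ge x_0$, $$\sum_{p<x} f_1(p)\le C\,x\,(\log x)^5(\log\log x)^2,$$ where the sum runs over prime numbers $p<x$, and for a prime $p$, $f_1(p)$ denotes the number of triples $(n_1,n_2,n_3)$ of positive integers satisfying $$\frac{4}{p}=\frac{1}{n_1}+\frac{1}{n_2}+\frac{1}{n_3}$$ such that exactly one of the denominators $n_1,n_2,n_3$ is divisible by $p$.
   Context: Triples $(n_1,n_2,n_3)$ are ordered triples of positive integers. $\log$ is the natural logarithm. *)

theory Defs
  imports Complex_Main "HOL-Computational_Algebra.Primes"
begin

definition ES_triples :: "nat \<Rightarrow> (nat \<times> nat \<times> nat) set" where
  "ES_triples p = {(n1, n2, n3). n1 > 0 \<and> n2 > 0 \<and> n3 > 0 \<and>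
     4 / real p = 1 / real n1 + 1 / real n2 + 1 / real n3}"

text \<open>``Exactly one'' refers to positions: a triple with two equal entries, both divisible
  by \<open>p\<close>, has two denominators divisible by \<open>p\<close>.\<close>

definition f1 :: "nat \<Rightarrow> nat" where
  "f1 p = card {(n1, n2, n3). (n1, n2, n3) \<in> ES_triples p \<and>
     (p dvd n1 \<and> \<not> p dvd n2 \<and> \<not> p dvd n3 \<or>
      \<not> p dvd n1 \<and> p dvd n2 \<and> \<not> p dvd n3 \<or>
      \<not> p dvd n1 \<and> \<not> p dvd n2 \<and> p dvd n3)}"

text \<open>The set counted by \<open>f1\<close> is finite, so \<open>card\<close> is the genuine number of solutions.\<close>

lemma ES_sorted_bound:
  fixes a b c p :: nat
  assumes p: "p > 0" and a: "a > 0" and ab: "a \<le> b" and bc: "b \<le> c"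
    and eq: "4 / real p = 1 / real a + 1 / real b + 1 / real c"
  shows "c \<le> 2 * p ^ 4"
proof -
  have pos: "b > 0" "c > 0" using a ab bc by auto
  have "real (4 * a * b * c) = real (p * (b * c + a * c + a * b))"
    using eq p a pos by (simp add: field_simps)
  hence e: "4 * a * b * c = p * (b * c + a * c + a * b)"
    by (simp only: of_nat_eq_iff)
  have ap: "a \<le> p"
  proof -
    have "b * c + a * c + a * b \<le> 3 * (b * c)"
    proof -
      have "a * c \<le> b * c" using ab by (rule mult_le_mono1)
      moreover have "a * b \<le> b * c" using ab bc by (subst mult.commute) (intro mult_le_mono, auto)
      ultimately show ?thesis by linarith
    qed
    hence "4 * a * (b * c) \<le> 3 * p * (b * c)"
      using e mult_le_mono2[of "b * c + a * c + a * b" "3 * (b * c)" p] by (simp add: mult_ac)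
    hence "4 * a \<le> 3 * p" using pos by simp
    thus ?thesis by simp
  qed
  have lt: "p < 4 * a"
  proof (rule ccontr)
    assume "\<not> ?thesis"
    hence "4 * a * (b * c) \<le> p * (b * c)" by (intro mult_le_mono1) simp
    moreover have "p * (a * c) > 0" using p a pos by simp
    moreover have "4 * a * (b * c) = p * (b * c) + p * (a * c) + p * (a * b)"
      using e by (simp only: distrib_left mult.assoc)
    ultimately show False by linarith
  qed
  then obtain d where d: "4 * a = p + d" "d \<ge> 1"
    by (metis less_imp_add_positive Suc_leI One_nat_def)
  have "(p + d) * (b * c) = p * (b * c + a * c + a * b)"
    unfolding d(1)[symmetric] using e by (simp only: mult.assoc)
  hence e2: "d * (b * c) = p * a * (b + c)" by (simp add: algebra_simps)
  have b_le: "b \<le> 2 * p * a"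
  proof -
    have "b * c \<le> d * (b * c)" using d by simp
    also have "\<dots> \<le> p * a * (2 * c)" unfolding e2 using bc by (intro mult_le_mono) auto
    finally have "b * c \<le> (2 * p * a) * c" by (simp add: mult_ac)
    thus ?thesis using pos by simp
  qed
  have lt2: "p * a < d * b"
  proof (rule ccontr)
    assume "\<not> ?thesis"
    hence "d * b * c \<le> p * a * c" by (intro mult_le_mono1) simp
    moreover have "p * a * b > 0" using p a pos by simp
    moreover have "d * b * c = p * a * b + p * a * c"
      using e2 by (simp only: distrib_left mult.assoc)
    ultimately show False by linarith
  qed
  then obtain g where g: "d * b = p * a + g" "g \<ge> 1"
    by (metis less_imp_add_positive Suc_leI One_nat_def)
  have "(p * a + g) * c = p * a * (b + c)"
    unfolding g(1)[symmetric] using e2 by (simp only: mult.assoc)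
  hence "g * c = p * a * b" by (simp add: algebra_simps)
  hence "c \<le> p * a * b" using g by (metis mult_le_mono1 mult_1)
  also have "\<dots> \<le> p * p * (2 * p * p)"
    using ap b_le by (intro mult_le_mono) (auto intro: order_trans)
  also have "\<dots> = 2 * p ^ 4" by (simp add: power4_eq_xxxx mult_ac)
  finally show ?thesis .
qed

lemma finite_ES_triples:
  assumes p: "p > 0"
  shows "finite (ES_triples p)"
proof (rule finite_subset)
  let ?B = "2 * p ^ 4"
  show "ES_triples p \<subseteq> {..?B} \<times> {..?B} \<times> {..?B}"
  proof (clarify, unfold mem_Times_iff fst_conv snd_conv atMost_iff)
    fix a b c assume "(a, b, c) \<in> ES_triples p"
    hence h: "a > 0" "b > 0" "c > 0" "4 / real p = 1 / real a + 1 / real b + 1 / real c"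
      by (auto simp: ES_triples_def)
    have perms: "4 / real p = 1 / real a + 1 / real c + 1 / real b"
      "4 / real p = 1 / real b + 1 / real a + 1 / real c"
      "4 / real p = 1 / real b + 1 / real c + 1 / real a"
      "4 / real p = 1 / real c + 1 / real a + 1 / real b"
      "4 / real p = 1 / real c + 1 / real b + 1 / real a"
      using h(4) by (simp_all add: add_ac)
    note r = ES_sorted_bound[OF p]
    consider "a \<le> b" "b \<le> c" | "a \<le> c" "c \<le> b" | "b \<le> a" "a \<le> c"
      | "b \<le> c" "c \<le> a" | "c \<le> a" "a \<le> b" | "c \<le> b" "b \<le> a" by linarith
    thus "a \<le> ?B \<and> b \<le> ?B \<and> c \<le> ?B"
    proof cases
      case 1 thus ?thesis using r[OF h(1) _ _ h(4)] by linarith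
    next
      case 2 thus ?thesis using r[OF h(1) _ _ perms(1)] by linarith
    next
      case 3 thus ?thesis using r[OF h(2) _ _ perms(2)] by linarith
    next
      case 4 thus ?thesis using r[OF h(2) _ _ perms(3)] by linarith
    next
      case 5 thus ?thesis using r[OF h(3) _ _ perms(4)] by linarith
    next
      case 6 thus ?thesis using r[OF h(3) _ _ perms(5)] by linarith
    qed
  qed
qed simp

end

theory Submission
  imports Defs "HOL-Analysis.Convex"
begin

text \<open>If only \<open>n1\<close> is divisible by \<open>p\<close> and \<open>n2 \<le> n3\<close>, then \<open>n1 = abdp\<close>, \<open>n2 = acd\<close>, \<open>n3 = bcd\<close> with
  \<open>a + b = ce\<close> and \<open>4abd = pe + 1\<close>. Hence \<open>acd \<le> p\<close>, \<open>e\<close> divides \<open>4a\<^sup>2d + 1\<close>, and \<open>(a, c, d, e)\<close>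
  determines the solution together with \<open>p\<close>, so the sum is at most six times the sum of
  \<open>\<tau>(4a\<^sup>2d + 1)\<close> over \<open>acd \<le> x\<close>. The primality of \<open>p\<close> plays no further role.

  The divisor function is controlled by small divisors only:
  \<open>\<tau>(n) \<le> 32 \<Sum> (3/2)\<^bsup>\<omega>(m)\<^esup>\<close> over the divisors \<open>m\<close> of \<open>n\<close> with \<open>m\<^sup>3 \<le> n\<close>. For \<open>n = 4a\<^sup>2d + 1\<close> such \<open>m\<close> are
  less than \<open>2 max(a, d)\<close>, so the larger of the two variables runs over a range at least comparable
  to \<open>m\<close>. It satisfies a linear congruence (one root) or a quadratic one (at most \<open>2\<^bsup>\<omega>(m)\<^esup>\<close>
  roots) modulo \<open>m\<close>. Summing \<open>3\<^bsup>\<omega>(m)\<^esup>/m\<close> costs three logarithms, and the two remaining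
  variables cost two.\<close>

section \<open>Multiplicative functions on divisors\<close>

definition omega :: "nat \<Rightarrow> nat" where
  "omega n = card (prime_factors n)"

definition tau :: "nat \<Rightarrow> nat" where
  "tau n = card {d. d dvd n}"

text \<open>The ternary divisor function: for positive \<open>n\<close> it counts the ordered
  factorizations into three factors.\<close>

definition tau3 :: "nat \<Rightarrow> nat" where
  "tau3 n = (\<Sum>d | d dvd n. tau (n div d))"

text \<open>Splitting off the full power of one prime leaves a smaller cofactor. This reduces
  inequalities between multiplicative functions to prime powers.\<close>

lemma coprime_prime_power_induct [consumes 1, case_names one step]:
  fixes n :: nat
  assumes "n > 0" and one: "P 1"
    and step: "\<And>p k n. prime p \<Longrightarrow> k > 0 \<Longrightarrow> n > 0 \<Longrightarrow> \<not> p dvd n \<Longrightarrow> P n \<Longrightarrow> P (p ^ k * n)"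
  shows "P n"
  using assms(1)
proof (induction n rule: less_induct)
  case (less n)
  show ?case
  proof (cases "n = 1")
    case True
    then show ?thesis using one by simp
  next
    case False
    then obtain p where p: "prime p" "p dvd n"
      using prime_factor_nat by blast
    have "\<not> is_unit p" using p(1) by auto
    then obtain m where m: "n = p ^ multiplicity p n * m" "\<not> p dvd m"
      using multiplicity_decompose'[of n p] less.prems by auto
    have k: "multiplicity p n > 0"
      using p less.prems by (simp add: prime_multiplicity_gt_zero_iff)
    have m0: "m > 0" using m less.prems by (intro Nat.gr0I) auto
    have "1 < p ^ multiplicity p n"
      using k p(1) prime_gt_1_nat by (metis one_less_power)
    then have "m < n" using m(1) m0 by (metis mult_less_cancel2 nat_mult_1)
    then show ?thesis using step[OF p(1) k m0 m(2)] less.IH m0 m(1) by metis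
  qed
qed

text \<open>A divisor of \<open>p ^ k * n\<close> is \<open>p ^ j * d\<close> in exactly one way,
  \<open>j\<close> being its multiplicity at \<open>p\<close>. Divisor sums of multiplicative
  summands thus split off a local factor.\<close>

lemma sum_divisors_prime_power_mult:
  fixes F :: "nat \<Rightarrow> 'a::comm_monoid_add"
  assumes p: "prime p" and n: "n > 0" "\<not> p dvd n"
  shows "(\<Sum>d | d dvd p ^ k * n. F d) = (\<Sum>j\<le>k. \<Sum>d | d dvd n. F (p ^ j * d))"
proof -
  have "bij_betw (\<lambda>(j, d). p ^ j * d) ({..k} \<times> {d. d dvd n}) {d. d dvd p ^ k * n}"
    unfolding bij_betw_def
  proof
    show "inj_on (\<lambda>(j, d). p ^ j * d) ({..k} \<times> {d. d dvd n})"
    proof (rule inj_onI, clarsimp)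
      fix i d j e
      assume d: "d dvd n" and e: "e dvd n" and eq: "p ^ i * d = p ^ j * e"
      have *: "multiplicity p (p ^ l * c) = l" if "c dvd n" for c l
      proof -
        have "\<not> p dvd c" using that n(2) by (meson dvd_trans)
        moreover have "c \<noteq> 0" using that n(1) by auto
        ultimately show ?thesis
          using p by (simp add: prime_elem_multiplicity_mult_distrib not_dvd_imp_multiplicity_0
              prime_gt_0_nat prime_gt_1_nat)
      qed
      have "i = j" using *[OF d, of i] *[OF e, of j] eq by simp
      then show "i = j \<and> d = e" using eq p by (auto simp: prime_gt_0_nat)
    qed
    show "(\<lambda>(j, d). p ^ j * d) ` ({..k} \<times> {d. d dvd n}) = {d. d dvd p ^ k * n}"
    proof (intro equalityI subsetI)
      fix x assume "x \<in> (\<lambda>(j, d). p ^ j * d) ` ({..k} \<times> {d. d dvd n})"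
      then show "x \<in> {d. d dvd p ^ k * n}"
        by (auto intro!: mult_dvd_mono le_imp_power_dvd)
    next
      fix x assume "x \<in> {d. d dvd p ^ k * n}"
      then obtain b c where "x = b * c" "b dvd p ^ k" "c dvd n"
        by (auto elim: dvd_productE)
      then show "x \<in> (\<lambda>(j, d). p ^ j * d) ` ({..k} \<times> {d. d dvd n})"
        using p by (auto simp: divides_primepow_nat)
    qed
  qed
  from sum.reindex_bij_betw[OF this, of F, symmetric] show ?thesis
    by (simp add: sum.cartesian_product case_prod_unfold)
qed

lemma omega_1 [simp]: "omega 1 = 0" "omega (Suc 0) = 0"
  by (simp_all add: omega_def)

lemma omega_prime_power_mult:
  assumes p: "prime p" and n: "n > 0" "\<not> p dvd n"
  shows "omega (p ^ j * n) = (if j = 0 then 0 else 1) + omega n"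
proof (cases "j = 0")
  case False
  have "prime_factors (p ^ j * n) = insert p (prime_factors n)"
    using p n False by (auto simp: prime_factorization_mult prime_factorization_prime_power)
  moreover have "p \<notin> prime_factors n" using n by auto
  ultimately show ?thesis using False by (simp add: omega_def)
qed simp

lemma tau_pos: "n > 0 \<Longrightarrow> tau n > 0"
  unfolding tau_def by (auto simp: card_gt_0_iff)

lemma tau_prime_power_mult:
  assumes "prime p" "n > 0" "\<not> p dvd n"
  shows "tau (p ^ k * n) = (k + 1) * tau n"
  using sum_divisors_prime_power_mult[OF assms, of "\<lambda>_. 1::nat" k] by (simp add: tau_def)

lemma div_prime_power_mult:
  fixes p :: nat
  assumes "p > 0" "j \<le> k" "d dvd n"
  shows "p ^ k * n div (p ^ j * d) = p ^ (k - j) * (n div d)"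
proof -
  have "p ^ k = p ^ j * p ^ (k - j)" using assms(2) by (simp flip: power_add)
  then have "p ^ k * n div (p ^ j * d) = p ^ j * (p ^ (k - j) * n) div (p ^ j * d)"
    by (simp add: mult.assoc)
  also have "\<dots> = p ^ (k - j) * n div d"
    using assms(1) by (subst div_mult_mult1) auto
  finally show ?thesis using assms(3) by (simp add: div_mult_swap)
qed

lemma tau_div_prime_power_mult:
  assumes "prime p" "n > 0" "\<not> p dvd n" "j \<le> k" "d dvd n"
  shows "tau (p ^ k * n div (p ^ j * d)) = (k - j + 1) * tau (n div d)"
proof -
  have "\<not> p dvd n div d" using assms by (metis dvd_div_mult_self dvd_mult2)
  moreover have "n div d > 0" using assms by (metis div_greater_zero_iff dvd_imp_le gr0I dvd_0_left)
  ultimately show ?thesis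
    using assms by (simp add: div_prime_power_mult prime_gt_0_nat tau_prime_power_mult)
qed

text \<open>The local value at \<open>p ^ k\<close> is the binomial coefficient "k + 2 choose 2";
  doubling avoids a division.\<close>

lemma tau3_prime_power_mult:
  assumes "prime p" "n > 0" "\<not> p dvd n"
  shows "2 * tau3 (p ^ k * n) = (k + 1) * (k + 2) * tau3 n"
proof -
  have "tau3 (p ^ k * n) = (\<Sum>j\<le>k. \<Sum>d | d dvd n. (k - j + 1) * tau (n div d))"
    unfolding tau3_def sum_divisors_prime_power_mult[OF assms]
    using assms by (intro sum.cong refl) (auto simp: tau_div_prime_power_mult)
  also have "\<dots> = (\<Sum>j\<le>k. k - j + 1) * tau3 n"
    by (simp only: tau3_def sum_product)
  also have "(\<Sum>j\<le>k. k - j + 1) = (\<Sum>j\<le>k. j + 1)"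
    using sum.nat_diff_reindex[of "\<lambda>j. j + 1" "Suc k"] by (simp add: lessThan_Suc_atMost)
  also have "2 * ((\<Sum>j\<le>k. j + 1) * tau3 n) = (2 * (\<Sum>j\<le>k. j + 1)) * tau3 n" by simp
  also have "2 * (\<Sum>j\<le>k. j + 1) = (k + 1) * (k + 2)"
    by (induction k) auto
  finally show ?thesis .
qed

section \<open>Hoelder's inequality and its local factors\<close>

text \<open>Cauchy-Schwarz for i times i^(1/2) replaces a half-integral power sum by a polynomial in
  \<open>k\<close>.\<close>

lemma sum_sqrt_cube_le:
  "(\<Sum>i=1..k. real i * sqrt (real i))\<^sup>2 \<le> (real k)\<^sup>2 * (real k + 1)\<^sup>2 * (2 * real k + 1) / 12"
proof -
  have "(\<Sum>i=1..k. real i * sqrt (real i))\<^sup>2 \<le> (\<Sum>i=1..k. (real i)\<^sup>2) * (\<Sum>i=1..k. (sqrt (real i))\<^sup>2)"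
    by (rule Cauchy_Schwarz_ineq_sum)
  also have "(\<Sum>i=1..k. (real i)\<^sup>2) = real k * (real k + 1) * (2 * real k + 1) / 6"
    by (induction k) (auto simp: field_simps power2_eq_square)
  also have "(\<Sum>i=1..k. (sqrt (real i))\<^sup>2) = real k * (real k + 1) / 2"
    by (induction k) (auto simp: field_simps)
  finally show ?thesis by (simp add: power2_eq_square mult_ac)
qed

text \<open>The dual factor in Hoelder's inequality for \<open>\<Sum> \<tau>(n/d)\<close>, with exponents \<open>3\<close> and \<open>3/2\<close> and
  weight \<open>(3/2)\<^bsup>\<omega>(d)\<^esup>\<close>.\<close>
definition hoelder_sum :: "nat \<Rightarrow> real" where
  "hoelder_sum n = (\<Sum>d | d dvd n. sqrt (real (tau (n div d)) ^ 3 * (2/3) ^ omega d))"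

text \<open>The prime-power case of \<open>hoelder_sum_le\<close>. The weight 3/2 just suffices in
  the tight case k = 1 (about 26.6 against 27), and its double is the base 3 of
  \<open>sum_three_power_omega_le\<close>.\<close>

lemma hoelder_local_factor_le:
  "(real k + 1) * (\<Sum>j\<le>k. sqrt (real (k - j + 1) ^ 3 * (2/3) ^ (if j = 0 then 0 else 1)))\<^sup>2
     \<le> ((real k + 1) * (real k + 2) / 2) ^ 3"
proof -
  define x where "x = real k"
  have x: "x \<ge> 0" by (simp add: x_def)
  \<comment> \<open>Up to the common factor \<open>x + 1\<close>, \<open>a\<close> is the term j = 0
    and \<open>b\<close> the Cauchy-Schwarz bound for all other terms.\<close>
  define a where "a = sqrt (x + 1)"
  define b where "b = x * sqrt ((2 * x + 1) / 18)"
  have cube: "sqrt (y ^ 3) = y * sqrt y" if "y \<ge> 0" for y :: real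
    using that by (simp add: power3_eq_cube real_sqrt_mult)
  have "(\<Sum>j\<le>k. sqrt (real (k - j + 1) ^ 3 * (2/3) ^ (if j = 0 then 0 else 1)))
      = sqrt ((x + 1) ^ 3) + (\<Sum>j=1..k. sqrt (real (k - j + 1) ^ 3 * (2/3)))"
  proof -
    have "{..k} = insert 0 {1..k}" by auto
    then show ?thesis by (simp add: x_def add.commute)
  qed
  also have "(\<Sum>j=1..k. sqrt (real (k - j + 1) ^ 3 * (2/3))) = (\<Sum>i=1..k. sqrt (real i ^ 3 * (2/3)))"
    by (rule sum.reindex_bij_witness[of _ "\<lambda>i. k + 1 - i" "\<lambda>i. k + 1 - i"])
      (auto simp: of_nat_diff add_diff_eq)
  also have "\<dots> = sqrt (2/3) * (\<Sum>i=1..k. real i * sqrt (real i))"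
    by (simp only: real_sqrt_mult cube of_nat_0_le_iff sum_distrib_left mult_ac)
  also have "\<dots> \<le> (x + 1) * b"
  proof (rule power2_le_imp_le)
    have "(sqrt (2/3) * (\<Sum>i=1..k. real i * sqrt (real i)))\<^sup>2
        \<le> (2/3) * ((real k)\<^sup>2 * (real k + 1)\<^sup>2 * (2 * real k + 1) / 12)"
      unfolding power_mult_distrib using sum_sqrt_cube_le[of k]
      by (intro mult_mono) auto
    also have "\<dots> = ((x + 1) * b)\<^sup>2"
      using x by (simp add: x_def b_def power_mult_distrib)
    finally show "(sqrt (2/3) * (\<Sum>i=1..k. real i * sqrt (real i)))\<^sup>2 \<le> ((x + 1) * b)\<^sup>2" .
  qed (use x in \<open>simp add: b_def\<close>)
  finally have le: "(\<Sum>j\<le>k. sqrt (real (k - j + 1) ^ 3 * (2/3) ^ (if j = 0 then 0 else 1))) \<le> (x + 1) * (a + b)"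
    using x by (simp add: cube a_def algebra_simps)
  \<comment> \<open>The right side is exactly what (x + 2)^3 / 8 leaves for the cross term of (a +
    b)^2 after the two squares are subtracted.\<close>
  have ab: "2 * (a * b) \<le> x * (x\<^sup>2 + 50 * x + 36) / 72"
  proof (rule power2_le_imp_le)
    have "(2 * (a * b))\<^sup>2 = x\<^sup>2 * (4 * (x + 1) * (2 * x + 1) / 18)"
      using x by (simp add: a_def b_def power_mult_distrib)
    also have "\<dots> \<le> x\<^sup>2 * ((x\<^sup>2 + 50 * x + 36)\<^sup>2 / 72\<^sup>2)"
    proof (rule mult_left_mono)
      \<comment> \<open>The difference is a polynomial with nonnegative coefficients; 1152 is 72^2 *
        4 / 18.\<close>
      have "1152 * (x + 1) * (2 * x + 1) + (x ^ 4 + 100 * x ^ 3 + 268 * x\<^sup>2 + 144 * x + 144) = (x\<^sup>2 + 50 * x + 36)\<^sup>2"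
        by (simp add: power2_eq_square power3_eq_cube power4_eq_xxxx algebra_simps)
      moreover have "x ^ 4 + 100 * x ^ 3 + 268 * x\<^sup>2 + 144 * x + 144 \<ge> 0" using x by simp
      ultimately have "1152 * (x + 1) * (2 * x + 1) \<le> (x\<^sup>2 + 50 * x + 36)\<^sup>2" by linarith
      then have "1152 * (x + 1) * (2 * x + 1) / 72\<^sup>2 \<le> (x\<^sup>2 + 50 * x + 36)\<^sup>2 / 72\<^sup>2"
        by (rule divide_right_mono) simp
      moreover have "4 * (x + 1) * (2 * x + 1) / 18 = 1152 * (x + 1) * (2 * x + 1) / 72\<^sup>2"
        by (simp add: field_simps)
      ultimately show "4 * (x + 1) * (2 * x + 1) / 18 \<le> (x\<^sup>2 + 50 * x + 36)\<^sup>2 / 72\<^sup>2"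
        by (simp only:)
    qed simp
    also have "\<dots> = (x * (x\<^sup>2 + 50 * x + 36) / 72)\<^sup>2" by (simp add: power_mult_distrib power_divide)
    finally show "(2 * (a * b))\<^sup>2 \<le> (x * (x\<^sup>2 + 50 * x + 36) / 72)\<^sup>2" .
  qed (use x in simp)
  have "(a + b)\<^sup>2 = (x + 1) + x\<^sup>2 * (2 * x + 1) / 18 + 2 * (a * b)"
    using x by (simp add: power2_sum a_def b_def power_mult_distrib)
  also have "\<dots> \<le> (x + 2) ^ 3 / 8"
    using ab by (simp add: power2_eq_square power3_eq_cube field_simps)
  finally have "(x + 1) ^ 3 * (a + b)\<^sup>2 \<le> (x + 1) ^ 3 * ((x + 2) ^ 3 / 8)"
    using x by (intro mult_left_mono) auto
  also have "\<dots> = ((x + 1) * (x + 2) / 2) ^ 3"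
    by (simp add: power_mult_distrib power_divide)
  finally have "(x + 1) ^ 3 * (a + b)\<^sup>2 \<le> ((x + 1) * (x + 2) / 2) ^ 3" .
  moreover have "(x + 1) * (\<Sum>j\<le>k. sqrt (real (k - j + 1) ^ 3 * (2/3) ^ (if j = 0 then 0 else 1)))\<^sup>2
      \<le> (x + 1) * ((x + 1) * (a + b))\<^sup>2"
    using le x by (intro mult_left_mono power_mono sum_nonneg) auto
  moreover have "(x + 1) * ((x + 1) * (a + b))\<^sup>2 = (x + 1) ^ 3 * (a + b)\<^sup>2"
    by (simp add: power2_eq_square power3_eq_cube)
  ultimately show ?thesis
    unfolding x_def by linarith
qed

lemma hoelder_sum_prime_power_mult:
  assumes "prime p" "n > 0" "\<not> p dvd n"
  shows "hoelder_sum (p ^ k * n)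
    = (\<Sum>j\<le>k. sqrt (real (k - j + 1) ^ 3 * (2/3) ^ (if j = 0 then 0 else 1))) * hoelder_sum n"
proof -
  have om: "omega (p ^ j * d) = (if j = 0 then 0 else 1) + omega d" if "d dvd n" for d j
    using that assms by (intro omega_prime_power_mult) (auto intro: dvd_trans dvd_pos_nat)
  have "hoelder_sum (p ^ k * n) = (\<Sum>j\<le>k. \<Sum>d | d dvd n.
      sqrt (real (k - j + 1) ^ 3 * (2/3) ^ (if j = 0 then 0 else 1)) *
      sqrt (real (tau (n div d)) ^ 3 * (2/3) ^ omega d))"
    unfolding hoelder_sum_def sum_divisors_prime_power_mult[OF assms] real_sqrt_mult[symmetric]
  proof (intro sum.cong refl)
    fix j d assume "j \<in> {..k}" "d \<in> {d. d dvd n}"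
    then have *: "j \<le> k" "d dvd n" by auto
    show "sqrt (real (tau (p ^ k * n div (p ^ j * d))) ^ 3 * (2/3) ^ omega (p ^ j * d)) =
      sqrt (real (k - j + 1) ^ 3 * (2/3) ^ (if j = 0 then 0 else 1) *
        (real (tau (n div d)) ^ 3 * (2/3) ^ omega d))"
      unfolding tau_div_prime_power_mult[OF assms *] om[OF *(2)]
      by (simp only: of_nat_mult power_mult_distrib power_add mult_ac)
  qed
  then show ?thesis by (simp only: hoelder_sum_def sum_product)
qed

text \<open>\<open>tau\<close>, \<open>hoelder_sum\<close> and \<open>tau3\<close> are all
  multiplicative, so the local inequality multiplies up.\<close>

lemma hoelder_sum_le:
  assumes "n > 0"
  shows "real (tau n) * (hoelder_sum n)\<^sup>2 \<le> real (tau3 n) ^ 3"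
  using assms
proof (induction rule: coprime_prime_power_induct)
  case one
  then show ?case by (simp add: hoelder_sum_def tau3_def tau_def)
next
  case (step p k n)
  define L where "L = (\<Sum>j\<le>k. sqrt (real (k - j + 1) ^ 3 * (2/3) ^ (if j = 0 then 0 else 1)))"
  have "real (tau (p ^ k * n)) * (hoelder_sum (p ^ k * n))\<^sup>2 = ((real k + 1) * L\<^sup>2) * (real (tau n) * (hoelder_sum n)\<^sup>2)"
    unfolding tau_prime_power_mult[OF step.hyps(1,3,4)] hoelder_sum_prime_power_mult[OF step.hyps(1,3,4)]
      L_def[symmetric] power_mult_distrib
    by (simp add: algebra_simps)
  also have "\<dots> \<le> ((real k + 1) * (real k + 2) / 2) ^ 3 * real (tau3 n) ^ 3"
    using hoelder_local_factor_le[of k] step.IH unfolding L_def[symmetric]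
    by (intro mult_mono) auto
  also have "\<dots> = ((real k + 1) * (real k + 2) / 2 * real (tau3 n)) ^ 3"
    by (simp only: power_mult_distrib)
  also have "(real k + 1) * (real k + 2) / 2 * real (tau3 n) = real (tau3 (p ^ k * n))"
    using arg_cong[OF tau3_prime_power_mult[OF step.hyps(1,3,4), of k], of real]
    by (simp add: algebra_simps)
  finally show ?case .
qed

section \<open>Bounding the divisor function by divisors below the cube root\<close>

text \<open>The predicate \<open>Q\<close> on the first factor lets one count serve both all
  factorizations, giving \<open>tau3\<close>, and those with a small first factor.\<close>

lemma card_factor_triples:
  fixes n :: nat
  assumes n: "n > 0"
  shows "card {(i, j, k). i * j * k = n \<and> Q i} = (\<Sum>i | i dvd n \<and> Q i. tau (n div i))"
    and "finite {(i, j, k). i * j * k = n \<and> Q i}"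
proof -
  let ?S = "SIGMA i:{i. i dvd n \<and> Q i}. {j. j dvd n div i}"
  have fin: "finite {i. i dvd n \<and> Q i}" "\<And>i. i dvd n \<Longrightarrow> finite {j. j dvd n div i}"
    using n by (auto simp: dvd_div_eq_0_iff)
  have quot: "i dvd n \<and> j dvd n div i \<and> n div i div j = k" if "i * j * k = n" for i j k
  proof -
    have pos: "i > 0" "j > 0" using that n by (auto intro!: Nat.gr0I)
    have "n div i = j * k" unfolding that[symmetric] using pos by (simp add: mult.assoc)
    moreover have "i dvd n" unfolding that[symmetric] by (simp add: mult.assoc)
    ultimately show ?thesis using pos by simp
  qed
  have prod: "i * j * (n div i div j) = n" if "i dvd n" "j dvd n div i" for i j
    using that by (simp add: mult.assoc)
  have bij: "bij_betw (\<lambda>(i, j). (i, j, n div i div j)) ?S {(i, j, k). i * j * k = n \<and> Q i}"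
  proof (rule bij_betw_byWitness[where f' = "\<lambda>(i, j, k). (i, j)"])
    show "\<forall>t\<in>{(i, j, k). i * j * k = n \<and> Q i}.
        (case case t of (i, j, k) \<Rightarrow> (i, j) of (i, j) \<Rightarrow> (i, j, n div i div j)) = t"
      using quot by (auto simp del: div_mult_self_is_m)
    show "(\<lambda>(i, j). (i, j, n div i div j)) ` ?S \<subseteq> {(i, j, k). i * j * k = n \<and> Q i}"
      using prod by auto
    show "(\<lambda>(i, j, k). (i, j)) ` {(i, j, k). i * j * k = n \<and> Q i} \<subseteq> ?S"
      using quot by auto
  qed auto
  have "finite ?S" using fin by (intro finite_SigmaI) auto
  then show "finite {(i, j, k). i * j * k = n \<and> Q i}" by (simp only: bij_betw_finite[OF bij])
  have "card ?S = (\<Sum>i | i dvd n \<and> Q i. tau (n div i))"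
    unfolding tau_def using fin by (intro card_SigmaI) auto
  then show "card {(i, j, k). i * j * k = n \<and> Q i} = (\<Sum>i | i dvd n \<and> Q i. tau (n div i))"
    by (simp only: bij_betw_same_card[OF bij])
qed

text \<open>In a factorization into three factors, the smallest one is at most the cube root.\<close>
lemma tau3_le_small_divisors:
  assumes n: "n > 0"
  shows "tau3 n \<le> 3 * (\<Sum>d | d dvd n \<and> d ^ 3 \<le> n. tau (n div d))"
proof -
  define P where "P = {(i, j, k). i * j * k = n \<and> i ^ 3 \<le> n}"
  let ?P2 = "(\<lambda>(i, j, k). (j, i, k)) ` P" and ?P3 = "(\<lambda>(i, j, k). (k, j, i)) ` P"
  have fin: "finite P" and cardP: "card P = (\<Sum>d | d dvd n \<and> d ^ 3 \<le> n. tau (n div d))"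
    unfolding P_def using card_factor_triples[OF n, of "\<lambda>i. i ^ 3 \<le> n"] by auto
  \<comment> \<open>Swapping a small factor into first place moves a factorization into
    \<open>P\<close>. The conjunct \<open>True\<close> is the instance of \<open>Q\<close> that
    counts everything.\<close>
  have "{(i, j, k). i * j * k = n \<and> True} \<subseteq> P \<union> (?P2 \<union> ?P3)"
  proof
    fix t assume "t \<in> {(i, j, k). i * j * k = n \<and> True}"
    then obtain i j k where t: "t = (i, j, k)" and ijk: "i * j * k = n" by auto
    have "i ^ 3 \<le> n \<or> j ^ 3 \<le> n \<or> k ^ 3 \<le> n"
    proof (rule ccontr)
      assume "\<not> ?thesis"
      moreover have "i > 0" "j > 0" "k > 0" using n ijk by auto
      ultimately have "n * n * n < i ^ 3 * j ^ 3 * k ^ 3" using n by (intro mult_strict_mono) auto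
      then show False by (simp add: ijk[symmetric] power3_eq_cube mult_ac)
    qed
    moreover have "j * i * k = n" "k * j * i = n" using ijk by (simp_all only: mult_ac)
    ultimately consider "(i, j, k) \<in> P" | "(j, i, k) \<in> P" | "(k, j, i) \<in> P"
      using ijk unfolding P_def by blast
    then show "t \<in> P \<union> (?P2 \<union> ?P3)"
      unfolding t by cases (auto intro: rev_image_eqI)
  qed
  moreover have "finite (P \<union> (?P2 \<union> ?P3))" using fin by (intro finite_UnI finite_imageI)
  ultimately have "card {(i, j, k). i * j * k = n \<and> True} \<le> card (P \<union> (?P2 \<union> ?P3))"
    by (intro card_mono)
  also have "\<dots> \<le> card P + (card ?P2 + card ?P3)"
    using card_Un_le[of P "?P2 \<union> ?P3"] card_Un_le[of ?P2 ?P3] by linarith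
  also have "\<dots> \<le> 3 * card P"
    using card_image_le[OF fin, of "\<lambda>(i, j, k). (j, i, k)"]
      card_image_le[OF fin, of "\<lambda>(i, j, k). (k, j, i)"] by linarith
  finally show ?thesis
    unfolding card_factor_triples(1)[OF n] cardP by (simp add: tau3_def)
qed

text \<open>The inequality of the means for x, y, y: the difference of the cubes factors as (x -
  y)^2 (x + 8 y).\<close>

lemma amgm3:
  fixes x y g :: real
  assumes "x \<ge> 0" "y \<ge> 0" "g ^ 3 = x * y\<^sup>2"
  shows "3 * g \<le> x + 2 * y"
proof (rule power_le_imp_le_base)
  have "(x + 2 * y) ^ 3 - (3 * g) ^ 3 = (x - y)\<^sup>2 * (x + 8 * y)"
    unfolding power_mult_distrib assms(3) by (simp add: power2_eq_square power3_eq_cube algebra_simps)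
  also have "\<dots> \<ge> 0" using assms by simp
  finally show "(3 * g) ^ Suc 2 \<le> (x + 2 * y) ^ Suc 2" by (simp add: eval_nat_numeral)
qed (use assms in simp)

text \<open>Hoelder's inequality in scaled form: each tau(n/d) with small \<open>d\<close> splits
  into a weight and a dual term. By \<open>hoelder_sum_le\<close> the dual terms are absorbed by
  \<open>tau3\<close>, which then cancels.\<close>

lemma tau_le_small_divisors:
  assumes n: "n > 0"
  shows "real (tau n) \<le> 32 * (\<Sum>d | d dvd n \<and> d ^ 3 \<le> n. (3/2) ^ omega d)"
proof -
  define S where "S = {d. d dvd n \<and> d ^ 3 \<le> n}"
  define W where "W = (\<Sum>d\<in>S. (3/2 :: real) ^ omega d)"
  define r where "r d = sqrt (real (tau (n div d)) ^ 3 * (2/3) ^ omega d)" for d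
  define T where "T = real (tau n)"
  define U where "U = real (tau3 n)"
  \<comment> \<open>the scale at which the dual term below is at most half of \<open>U\<close>\<close>
  define s where "s = 4 * sqrt (U / T)"
  have T: "T > 0" using tau_pos[OF n] by (simp add: T_def)
  have "tau (n div 1) \<le> tau3 n"
    unfolding tau3_def using n by (intro member_le_sum) auto
  then have U: "U > 0" using tau_pos[OF n] by (simp add: U_def)
  have s: "s > 0" "s\<^sup>2 = 16 * U / T" using T U by (simp_all add: s_def power_mult_distrib)
  have S: "finite S" "S \<subseteq> {d. d dvd n}" using n by (auto simp: S_def)
  have R: "hoelder_sum n \<le> U * s / 4"
  proof (rule power2_le_imp_le)
    have "T * (hoelder_sum n)\<^sup>2 \<le> U ^ 3" using hoelder_sum_le[OF n] by (simp add: T_def U_def)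
    then have "(hoelder_sum n)\<^sup>2 \<le> U ^ 3 / T" using T by (simp add: field_simps)
    also have "\<dots> = U\<^sup>2 * s\<^sup>2 / 16"
      unfolding s(2) by (simp add: power2_eq_square power3_eq_cube)
    also have "\<dots> = (U * s / 4)\<^sup>2" by (simp add: power_mult_distrib power_divide)
    finally show "(hoelder_sum n)\<^sup>2 \<le> (U * s / 4)\<^sup>2" .
  qed (use U s in simp)
  have "real (tau3 n) \<le> real (3 * (\<Sum>d\<in>S. tau (n div d)))"
    using tau3_le_small_divisors[OF n] by (simp only: S_def of_nat_le_iff)
  then have "U \<le> (\<Sum>d\<in>S. 3 * real (tau (n div d)))"
    by (simp only: U_def of_nat_mult of_nat_sum of_nat_numeral sum_distrib_left)
  \<comment> \<open>\<open>amgm3\<close> with x the scaled weight and y = \<open>r d / s\<close>: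
    both the powers of \<open>s\<close> and the weights cancel in x y^2.\<close>
  also have "\<dots> \<le> (\<Sum>d\<in>S. s\<^sup>2 * (3/2) ^ omega d + 2 * (r d / s))"
  proof (intro sum_mono amgm3)
    fix d
    have "s\<^sup>2 * (3/2) ^ omega d * (r d / s)\<^sup>2 = (3/2) ^ omega d * (r d)\<^sup>2"
      using s(1) by (simp add: power_divide)
    also have "\<dots> = real (tau (n div d)) ^ 3 * ((3/2) ^ omega d * (2/3) ^ omega d)"
      by (simp add: r_def)
    also have "(3/2 :: real) ^ omega d * (2/3) ^ omega d = 1" by (simp flip: power_mult_distrib)
    finally show "real (tau (n div d)) ^ 3 = s\<^sup>2 * (3/2) ^ omega d * (r d / s)\<^sup>2" by simp
  qed (use s T U in \<open>auto simp: r_def\<close>)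
  also have "\<dots> = s\<^sup>2 * W + 2 / s * (\<Sum>d\<in>S. r d)"
    by (simp add: sum.distrib W_def sum_distrib_left sum_distrib_right sum_divide_distrib mult_ac)
  also have "\<dots> \<le> 16 * U / T * W + U / 2"
  proof (rule add_mono)
    have "(\<Sum>d\<in>S. r d) \<le> hoelder_sum n"
      unfolding hoelder_sum_def r_def[symmetric] using S n by (intro sum_mono2) (auto simp: r_def)
    also note R
    finally have "2 / s * (\<Sum>d\<in>S. r d) \<le> 2 / s * (U * s / 4)"
      by (rule mult_left_mono) (use s(1) in simp)
    then show "2 / s * (\<Sum>d\<in>S. r d) \<le> U / 2" using s(1) by simp
  qed (simp only: s(2) order.refl)
  \<comment> \<open>Half of \<open>U\<close> has absorbed the dual sum, so 16 becomes 32.\<close>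
  finally have "U / 2 \<le> 16 * U / T * W" by simp
  then have "T \<le> 32 * W" using T U by (simp add: field_simps)
  then show ?thesis by (simp add: T_def W_def S_def)
qed

section \<open>Roots modulo \<open>m\<close>\<close>

lemma dvd_of_prime_powers_dvd:
  fixes m :: nat and z :: int
  assumes m: "m > 0" and *: "\<And>q. q \<in> prime_factors m \<Longrightarrow> int (q ^ multiplicity q m) dvd z"
  shows "int m dvd z"
proof (cases "z = 0")
  case False
  have "m dvd nat \<bar>z\<bar>"
  proof (rule multiplicity_le_imp_dvd)
    fix q :: nat assume q: "prime q"
    show "multiplicity q m \<le> multiplicity q (nat \<bar>z\<bar>)"
    proof (cases "q \<in> prime_factors m")
      case True
      then have "q ^ multiplicity q m dvd nat \<bar>z\<bar>" using * by (simp add: dvd_nat_abs_iff)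
      then show ?thesis using False q by (intro multiplicity_geI) auto
    next
      case notin: False
      then have "multiplicity q m = 0" using q m by (auto simp: prime_factors_multiplicity)
      then show ?thesis by simp
    qed
  qed (use m in simp)
  then show ?thesis by (simp add: dvd_nat_abs_iff)
qed simp

text \<open>Residue and block index \<open>a div m\<close> determine a number, so a residue class
  has at most \<open>Y div m + 1\<close> members in \<open>{1..Y}\<close>.\<close>

lemma eq_of_div_eq_dvd:
  fixes a b m :: nat
  assumes "a div m = b div m" "int m dvd int a - int b"
  shows "a = b"
proof -
  have "int a mod int m = int b mod int m" using assms(2) by (simp add: mod_eq_dvd_iff)
  then have "a mod m = b mod m" by (metis of_nat_eq_iff of_nat_mod)
  then show ?thesis using assms(1) by (metis div_mult_mod_eq)
qed

text \<open>Once a root exists, \<open>4 * a\<^sup>2\<close> is invertible modulo \<open>m\<close>,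
  as a common divisor would divide 1. The roots thus lie in one residue class.\<close>

lemma card_linear_roots_le:
  fixes m :: nat
  assumes m: "m > 0"
  shows "card {d \<in> {1..Y}. m dvd 4 * a\<^sup>2 * d + 1} \<le> Y div m + 1"
proof -
  have "inj_on (\<lambda>d. d div m) {d \<in> {1..Y}. m dvd 4 * a\<^sup>2 * d + 1}"
  proof (rule inj_onI)
    fix d e assume "d \<in> {d \<in> {1..Y}. m dvd 4 * a\<^sup>2 * d + 1}" "e \<in> {d \<in> {1..Y}. m dvd 4 * a\<^sup>2 * d + 1}"
      and eq: "d div m = e div m"
    then have d: "m dvd 4 * a\<^sup>2 * d + 1" and e: "m dvd 4 * a\<^sup>2 * e + 1" by blast+
    have "coprime m (4 * a\<^sup>2)"
    proof (rule coprimeI)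
      fix c assume "c dvd m" "c dvd 4 * a\<^sup>2"
      then have "c dvd 4 * a\<^sup>2 * d" by (simp only: dvd_mult2)
      moreover have "c dvd 4 * a\<^sup>2 * d + 1" using \<open>c dvd m\<close> d by (rule dvd_trans)
      ultimately show "is_unit c" using dvd_add_right_iff by blast
    qed
    then have cop: "coprime (int m) (int (4 * a\<^sup>2))" by (simp only: coprime_int_iff)
    have "int m dvd int (4 * a\<^sup>2 * d + 1) - int (4 * a\<^sup>2 * e + 1)"
      using d e by (intro dvd_diff) (simp_all only: int_dvd_int_iff)
    also have "\<dots> = int (4 * a\<^sup>2) * (int d - int e)" by (simp add: algebra_simps)
    finally have "int m dvd int d - int e" using cop by (simp only: coprime_dvd_mult_right_iff)
    then show "d = e" using eq eq_of_div_eq_dvd by blast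
  qed
  moreover have "(\<lambda>d. d div m) ` {d \<in> {1..Y}. m dvd 4 * a\<^sup>2 * d + 1} \<subseteq> {..Y div m}"
    by (auto intro: div_le_mono)
  ultimately have "card {d \<in> {1..Y}. m dvd 4 * a\<^sup>2 * d + 1} \<le> card {..Y div m}"
    by (rule card_inj_on_le) simp
  then show ?thesis by simp
qed

text \<open>The two values differ by 4d(a - b)(a + b). Here \<open>q\<close> does not divide 4d, and
  dividing both other factors would force it to divide 2a, hence 4a^2 d; so \<open>q ^ k\<close>
  goes into one factor.\<close>

lemma prime_power_dvd_diff_or_sum:
  fixes q k a b d :: nat
  assumes q: "prime q" and k: "k > 0"
    and a: "q ^ k dvd 4 * a\<^sup>2 * d + 1" and b: "q ^ k dvd 4 * b\<^sup>2 * d + 1"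
  shows "q ^ k dvd a + b \<or> int (q ^ k) dvd int a - int b"
proof -
  have q': "prime (int q)" using q by simp
  have "q dvd q ^ k" using k by simp
  then have qa: "q dvd 4 * a\<^sup>2 * d + 1" using a dvd_trans by blast
  have not: "\<not> q dvd 4 * a\<^sup>2 * d"
  proof
    assume "q dvd 4 * a\<^sup>2 * d"
    then have "q dvd 1" using qa dvd_add_right_iff by blast
    then show False using q by auto
  qed
  have "int (q ^ k) dvd int (4 * a\<^sup>2 * d + 1) - int (4 * b\<^sup>2 * d + 1)"
    using a b by (intro dvd_diff) (simp_all only: int_dvd_int_iff)
  also have "\<dots> = int (4 * d) * ((int a - int b) * (int a + int b))"
    by (simp add: algebra_simps power2_eq_square)
  finally have dv: "int q ^ k dvd int (4 * d) * ((int a - int b) * (int a + int b))" by simp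
  have "\<not> q dvd 4 * d" using not by (metis dvd_mult2 mult.assoc mult.commute)
  then have "\<not> int q dvd int (4 * d)" by (simp only: int_dvd_int_iff simp_thms)
  then have "coprime (int q) (int (4 * d))" by (rule prime_imp_coprime[OF q'])
  then have "coprime (int q ^ k) (int (4 * d))" by (simp only: coprime_power_left_iff simp_thms)
  then have dv: "int q ^ k dvd (int a - int b) * (int a + int b)"
    using dv by (simp only: coprime_dvd_mult_right_iff)
  have "\<not> (int q dvd int a - int b \<and> int q dvd int a + int b)"
  proof
    assume "int q dvd int a - int b \<and> int q dvd int a + int b"
    then have "int q dvd (int a - int b) + (int a + int b)" by (blast intro: dvd_add)
    then have "int q dvd int (2 * a)" by simp
    then have "q dvd 2 * a" by (simp only: int_dvd_int_iff)
    then have "q dvd 2 * a * (2 * a * d)" by (rule dvd_mult2)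
    then show False using not by (simp add: power2_eq_square mult_ac)
  qed
  then consider "\<not> int q dvd int a - int b" | "\<not> int q dvd int a + int b" by blast
  then show ?thesis
  proof cases
    case 1
    then have "coprime (int q ^ k) (int a - int b)" using prime_imp_coprime[OF q'] by simp
    then have "int q ^ k dvd int a + int b" using dv by (simp only: coprime_dvd_mult_right_iff)
    then have "int (q ^ k) dvd int (a + b)" by simp
    then show ?thesis by (simp only: int_dvd_int_iff simp_thms)
  next
    case 2
    then have "coprime (int q ^ k) (int a + int b)" using prime_imp_coprime[OF q'] by simp
    then have "int q ^ k dvd int a - int b" using dv by (simp only: coprime_dvd_mult_left_iff)
    then show ?thesis by simp
  qed
qed

text \<open>Relative to a fixed root \<open>b\<close>, every root is b or -b modulo each prime power
  of \<open>m\<close>; the signs and the block index determine it.\<close>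

lemma card_quadratic_roots_le:
  fixes m :: nat
  assumes m: "m > 0"
  shows "card {a \<in> {1..Y}. m dvd 4 * a\<^sup>2 * d + 1} \<le> 2 ^ omega m * (Y div m + 1)"
proof (cases "{a \<in> {1..Y}. m dvd 4 * a\<^sup>2 * d + 1} = {}")
  case False
  define A where "A = {a \<in> {1..Y}. m dvd 4 * a\<^sup>2 * d + 1}"
  from False obtain b where b: "m dvd 4 * b\<^sup>2 * d + 1" by auto
  \<comment> \<open>\<open>a \<equiv> -b\<close> modulo the prime powers in \<open>T a\<close> and \<open>a \<equiv> b\<close> modulo the others\<close>
  define T where "T a = {q \<in> prime_factors m. q ^ multiplicity q m dvd a + b}" for a
  have "inj_on (\<lambda>a. (T a, a div m)) A"
  proof (rule inj_onI)
    fix a c assume "a \<in> A" "c \<in> A" and eq: "(T a, a div m) = (T c, c div m)"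
    then have a: "m dvd 4 * a\<^sup>2 * d + 1" and c: "m dvd 4 * c\<^sup>2 * d + 1" by (auto simp: A_def)
    have "int m dvd int a - int c"
    proof (rule dvd_of_prime_powers_dvd[OF m])
      fix q assume q: "q \<in> prime_factors m"
      define r where "r = q ^ multiplicity q m"
      have rm: "r dvd m" by (simp add: r_def multiplicity_dvd)
      have k: "prime q" "multiplicity q m > 0" using q by (auto simp: prime_factors_multiplicity)
      have or: "r dvd e + b \<or> int r dvd int e - int b" if "m dvd 4 * e\<^sup>2 * d + 1" for e
        unfolding r_def using rm that b unfolding r_def
        by (intro prime_power_dvd_diff_or_sum[OF k]) (auto intro: dvd_trans)
      \<comment> \<open>Equal sign sets make \<open>a\<close> and \<open>c\<close> both congruent to
        -b or both congruent to b modulo \<open>r\<close>.\<close>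
      have iff: "r dvd a + b \<longleftrightarrow> r dvd c + b" using eq q by (auto simp: T_def r_def)
      have "int r dvd int a - int c"
      proof (cases "r dvd a + b")
        case True
        then have "int r dvd int (a + b) - int (c + b)"
          using iff by (intro dvd_diff) (simp_all only: int_dvd_int_iff)
        then show ?thesis by simp
      next
        case False
        then have "int r dvd (int a - int b) - (int c - int b)"
          using or[OF a] or[OF c] iff by (blast intro: dvd_diff)
        then show ?thesis by simp
      qed
      then show "int (q ^ multiplicity q m) dvd int a - int c" by (simp add: r_def)
    qed
    then show "a = c" using eq eq_of_div_eq_dvd by blast
  qed
  moreover have "(\<lambda>a. (T a, a div m)) ` A \<subseteq> Pow (prime_factors m) \<times> {..Y div m}"
    by (auto simp: T_def A_def intro: div_le_mono)
  ultimately have "card A \<le> card (Pow (prime_factors m) \<times> {..Y div m})"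
    by (intro card_inj_on_le) auto
  then show ?thesis by (simp add: A_def omega_def card_cartesian_product card_Pow)
next
  case True
  then show ?thesis by (simp only: card.empty zero_le)
qed

section \<open>Averages\<close>

text \<open>For k > 0 the divisor sum has the local factor 1 + k t at \<open>p ^ k\<close>; keeping
  only the exponents 0 and 1 leaves 1 + t.\<close>

lemma power_omega_le:
  fixes t :: real
  assumes "n > 0" "t \<ge> 0"
  shows "(t + 1) ^ omega n \<le> (\<Sum>d | d dvd n. t ^ omega d)"
  using assms(1)
proof (induction rule: coprime_prime_power_induct)
  case one
  then show ?case by simp
next
  case (step p k n)
  have om: "omega (p ^ j * d) = (if j = 0 then 0 else 1) + omega d" if "d dvd n" for d j
    using that step by (intro omega_prime_power_mult) (auto intro: dvd_trans dvd_pos_nat)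
  define e :: "nat \<Rightarrow> nat" where "e j = (if j = 0 then 0 else 1)" for j
  have "t + 1 = (\<Sum>j\<in>{0,1}. t ^ e j)" by (simp add: e_def)
  also have "\<dots> \<le> (\<Sum>j\<le>k. t ^ e j)"
    using step.hyps(2) assms(2) by (intro sum_mono2) auto
  finally have "(t + 1) * (t + 1) ^ omega n \<le> (\<Sum>j\<le>k. t ^ e j) * (\<Sum>d | d dvd n. t ^ omega d)"
    using step.IH assms(2) by (intro mult_mono sum_nonneg) auto
  also have "\<dots> = (\<Sum>j\<le>k. \<Sum>d | d dvd n. t ^ omega (p ^ j * d))"
    unfolding sum_product by (intro sum.cong refl) (simp only: om mem_Collect_eq power_add e_def)
  also have "\<dots> = (\<Sum>d | d dvd p ^ k * n. t ^ omega d)"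
    by (rule sum_divisors_prime_power_mult[OF step.hyps(1,3,4), symmetric])
  finally show ?case using step.hyps by (simp add: omega_prime_power_mult)
qed

text \<open>Expand by \<open>power_omega_le\<close>, write m = d e and enlarge the region of pairs
  to a full square: the base drops by one at the cost of a harmonic sum.\<close>

lemma sum_power_omega_le:
  fixes t :: real
  assumes t: "t \<ge> 0"
  shows "(\<Sum>m=1..z. (t + 1) ^ omega m / m) \<le> (\<Sum>m=1..z. t ^ omega m / m) * (\<Sum>m=1..z. 1 / real m)"
proof -
  have "(\<Sum>m=1..z. (t + 1) ^ omega m / m) \<le> (\<Sum>m=1..z. \<Sum>d | d dvd m. t ^ omega d / m)"
    unfolding sum_divide_distrib[symmetric]
    using t by (intro sum_mono divide_right_mono power_omega_le) auto
  also have "\<dots> = (\<Sum>(m, d)\<in>(SIGMA m:{1..z}. {d. d dvd m}). t ^ omega d / m)"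
    by (rule sum.Sigma) auto
  also have "\<dots> = (\<Sum>(d, e)\<in>(\<lambda>(m, d). (d, m div d)) ` (SIGMA m:{1..z}. {d. d dvd m}). t ^ omega d / d * (1 / e))"
  proof (subst sum.reindex)
    show "inj_on (\<lambda>(m, d). (d, m div d)) (SIGMA m:{1..z}. {d. d dvd m})"
      by (rule inj_onI) (auto elim!: dvdE)
    show "(\<Sum>(m, d)\<in>(SIGMA m:{1..z}. {d. d dvd m}). t ^ omega d / m) =
      sum ((\<lambda>(d, e). t ^ omega d / d * (1 / e)) \<circ> (\<lambda>(m, d). (d, m div d))) (SIGMA m:{1..z}. {d. d dvd m})"
      by (intro sum.cong refl) (auto simp: real_of_nat_div elim!: dvdE)
  qed
  also have "\<dots> \<le> (\<Sum>(d, e)\<in>{1..z} \<times> {1..z}. t ^ omega d / d * (1 / e))"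
  proof (rule sum_mono2)
    show "(\<lambda>(m, d). (d, m div d)) ` (SIGMA m:{1..z}. {d. d dvd m}) \<subseteq> {1..z} \<times> {1..z}"
      by (auto simp: Suc_le_eq dvd_pos_nat div_greater_zero_iff dvd_imp_le intro: order_trans[OF div_le_dividend] order_trans[OF dvd_imp_le])
  qed (use t in auto)
  also have "\<dots> = (\<Sum>m=1..z. t ^ omega m / m) * (\<Sum>m=1..z. 1 / real m)"
    by (simp only: sum_product sum.cartesian_product)
  finally show ?thesis .
qed

lemma harmonic_le_ln:
  assumes "n > 0"
  shows "(\<Sum>m=1..n. 1 / real m) \<le> 1 + ln (real n)"
  using assms
proof (induction n rule: nat_induct_non_zero)
  case (Suc n)
  have "ln (real n / real (Suc n)) \<le> real n / real (Suc n) - 1"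
    using Suc by (intro ln_le_minus_one) simp
  also have "\<dots> = - (1 / real (Suc n))" by (simp add: field_simps)
  finally have "1 / real (Suc n) \<le> ln (real (Suc n)) - ln (real n)"
    using Suc by (simp add: ln_div)
  then show ?case using Suc by simp
qed simp

text \<open>Two reductions bring the base from 3 to 1, where a third harmonic sum remains.\<close>

lemma sum_three_power_omega_le:
  assumes z: "z > 0"
  shows "(\<Sum>m=1..z. 3 ^ omega m / real m) \<le> (1 + ln (real z)) ^ 3"
proof -
  define H where "H = (\<Sum>m=1..z. 1 / real m)"
  have H: "0 \<le> H" "H \<le> 1 + ln (real z)"
    using harmonic_le_ln[OF z] by (auto simp: H_def intro!: sum_nonneg)
  have "(\<Sum>m=1..z. 3 ^ omega m / real m) \<le> (\<Sum>m=1..z. 2 ^ omega m / real m) * H"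
    using sum_power_omega_le[of 2 z] by (simp add: H_def)
  also have "(\<Sum>m=1..z. 2 ^ omega m / real m) \<le> H * H"
    using sum_power_omega_le[of 1 z] by (simp add: H_def)
  also have "H * H * H \<le> (1 + ln (real z)) ^ 3"
    using H by (simp add: power3_eq_cube mult_mono)
  finally show ?thesis using H by (simp add: mult_right_mono)
qed

section \<open>Divisor sums along linear and quadratic values\<close>

text \<open>The cubic bound on \<open>h\<close> confines the small divisors to m < 2i, hence to m at
  most 2Y; exchanging the sums then leaves a count of roots modulo \<open>m\<close>.
  \<open>N\<close> enters only the logarithm, so the bound is uniform in \<open>Y\<close>.\<close>

lemma sum_tau_le:
  assumes I: "I \<subseteq> {1..Y}" and h0: "\<And>i. i \<in> I \<Longrightarrow> h i > 0"
    and h: "\<And>i. i \<in> I \<Longrightarrow> h i < (2 * i) ^ 3"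
    and card: "\<And>m. m > 0 \<Longrightarrow> card {i \<in> I. m dvd h i} \<le> 2 ^ omega m * (Y div m + 1)"
    and Y: "Y \<le> N"
  shows "(\<Sum>i\<in>I. real (tau (h i))) \<le> 96 * real Y * (1 + ln (2 * real N)) ^ 3"
proof (cases "Y = 0")
  case True
  then show ?thesis using I by simp
next
  case False
  have fin: "finite I" using I finite_subset by blast
  have "(\<Sum>i\<in>I. real (tau (h i))) \<le> (\<Sum>i\<in>I. \<Sum>m\<in>{1..2 * Y}. 32 * (if m dvd h i then (3/2) ^ omega m else 0))"
  proof (rule sum_mono)
    fix i assume i: "i \<in> I"
    have sub: "{m. m dvd h i \<and> m ^ 3 \<le> h i} \<subseteq> {m \<in> {1..2 * Y}. m dvd h i}"
    proof clarify
      fix m assume m: "m dvd h i" "m ^ 3 \<le> h i"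
      then have "m ^ 3 < (2 * i) ^ 3" using h[OF i] by simp
      then have "m < 2 * i" using power_less_imp_less_base by blast
      moreover have "m > 0" using m h0[OF i] by (auto intro!: Nat.gr0I)
      ultimately show "m \<in> {1..2 * Y}" using I i by auto
    qed
    have "real (tau (h i)) \<le> 32 * (\<Sum>m | m dvd h i \<and> m ^ 3 \<le> h i. (3/2) ^ omega m)"
      by (rule tau_le_small_divisors[OF h0[OF i]])
    also have "\<dots> \<le> 32 * (\<Sum>m\<in>{m \<in> {1..2 * Y}. m dvd h i}. (3/2) ^ omega m)"
      using sub by (intro mult_left_mono sum_mono2) auto
    also have "(\<Sum>m\<in>{m \<in> {1..2 * Y}. m dvd h i}. (3/2 :: real) ^ omega m)
        = (\<Sum>m\<in>{1..2 * Y}. if m dvd h i then (3/2) ^ omega m else 0)"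
      by (rule sum.inter_filter) simp
    finally show "real (tau (h i)) \<le> (\<Sum>m\<in>{1..2 * Y}. 32 * (if m dvd h i then (3/2) ^ omega m else 0))"
      by (simp only: sum_distrib_left)
  qed
  also have "\<dots> = (\<Sum>m\<in>{1..2 * Y}. 32 * ((3/2) ^ omega m * real (card {i \<in> I. m dvd h i})))"
  proof (subst sum.swap, intro sum.cong refl)
    fix m
    have "(\<Sum>i\<in>I. if m dvd h i then (3/2 :: real) ^ omega m else 0) = (\<Sum>i\<in>{i \<in> I. m dvd h i}. (3/2) ^ omega m)"
      by (rule sum.inter_filter[symmetric, OF fin])
    then show "(\<Sum>i\<in>I. 32 * (if m dvd h i then (3/2 :: real) ^ omega m else 0))
        = 32 * ((3/2) ^ omega m * real (card {i \<in> I. m dvd h i}))"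
      by (simp only: sum_distrib_left[symmetric] sum_constant mult.commute)
  qed
  also have "\<dots> \<le> (\<Sum>m\<in>{1..2 * Y}. 96 * real Y * (3 ^ omega m / real m))"
  proof (rule sum_mono)
    fix m assume m: "m \<in> {1..2 * Y}"
    have "real (card {i \<in> I. m dvd h i}) \<le> real (2 ^ omega m * (Y div m + 1))"
      using card[of m] m by (simp only: of_nat_le_iff) simp
    also have "\<dots> = 2 ^ omega m * (real (Y div m) + 1)" by (simp add: algebra_simps)
    \<comment> \<open>As m is at most 2Y, the rounding term 1 is absorbed into 2Y/m; hence 96 = 32 *
      3.\<close>
    also have "\<dots> \<le> 2 ^ omega m * (3 * real Y / real m)"
    proof (rule mult_left_mono)
      have "real (Y div m) \<le> real Y / real m" by (rule of_nat_div_le_of_nat)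
      moreover have "1 \<le> 2 * real Y / real m" using m by (simp add: field_simps)
      ultimately show "real (Y div m) + 1 \<le> 3 * real Y / real m" by simp
    qed simp
    finally have "32 * ((3/2) ^ omega m * real (card {i \<in> I. m dvd h i}))
        \<le> 32 * ((3/2) ^ omega m * (2 ^ omega m * (3 * real Y / real m)))"
      by (intro mult_left_mono) auto
    also have "\<dots> = 96 * real Y * (((3/2) ^ omega m * 2 ^ omega m) / real m)" by simp
    \<comment> \<open>The weight 3/2 meets two roots per prime.\<close>
    also have "(3/2 :: real) ^ omega m * 2 ^ omega m = 3 ^ omega m" by (simp flip: power_mult_distrib)
    finally show "32 * ((3/2) ^ omega m * real (card {i \<in> I. m dvd h i}))
        \<le> 96 * real Y * (3 ^ omega m / real m)" .
  qed
  also have "\<dots> = 96 * real Y * (\<Sum>m=1..2 * Y. 3 ^ omega m / real m)"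
    by (simp only: sum_distrib_left)
  also have "\<dots> \<le> 96 * real Y * (1 + ln (real (2 * Y))) ^ 3"
    using False by (intro mult_left_mono sum_three_power_omega_le) auto
  also have "\<dots> \<le> 96 * real Y * (1 + ln (2 * real N)) ^ 3"
    using False Y by (intro mult_left_mono power_mono add_left_mono) auto
  finally show ?thesis .
qed

text \<open>For d at least a, the value is below (2d)^3 and the congruence is linear in
  \<open>d\<close>.\<close>

lemma sum_tau_linear_le:
  assumes "a > 0" "Y \<le> N"
  shows "(\<Sum>d=a..Y. real (tau (4 * a\<^sup>2 * d + 1))) \<le> 96 * real Y * (1 + ln (2 * real N)) ^ 3"
proof (rule sum_tau_le)
  fix d assume d: "d \<in> {a..Y}"
  have "a * a * d \<le> d * d * d" using d by (intro mult_le_mono) auto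
  moreover have "d * d * d > 0" using d assms by simp
  ultimately have "4 * (a * a * d) + 1 < 8 * (d * d * d)" by linarith
  then show "4 * a\<^sup>2 * d + 1 < (2 * d) ^ 3" by (simp add: power2_eq_square power3_eq_cube mult_ac)
next
  fix m :: nat assume m: "m > 0"
  have "card {d \<in> {a..Y}. m dvd 4 * a\<^sup>2 * d + 1} \<le> card {d \<in> {1..Y}. m dvd 4 * a\<^sup>2 * d + 1}"
    using assms by (intro card_mono) auto
  also have "\<dots> \<le> 1 * (Y div m + 1)" using card_linear_roots_le[OF m, of Y a] by simp
  \<comment> \<open>One residue class is weakened to \<open>2 ^ omega m\<close> classes to fit
    \<open>sum_tau_le\<close>.\<close>
  also have "\<dots> \<le> 2 ^ omega m * (Y div m + 1)" by (intro mult_le_mono1) simp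
  finally show "card {d \<in> {a..Y}. m dvd 4 * a\<^sup>2 * d + 1} \<le> 2 ^ omega m * (Y div m + 1)" .
qed (use assms in auto)

lemma sum_tau_quadratic_le:
  assumes "d > 0" "Y \<le> N"
  shows "(\<Sum>a=d..Y. real (tau (4 * a\<^sup>2 * d + 1))) \<le> 96 * real Y * (1 + ln (2 * real N)) ^ 3"
proof (rule sum_tau_le)
  fix a assume a: "a \<in> {d..Y}"
  have "a * a * d \<le> a * a * a" using a by (intro mult_le_mono) auto
  moreover have "a * a * a > 0" using a assms by simp
  ultimately have "4 * (a * a * d) + 1 < 8 * (a * a * a)" by linarith
  then show "4 * a\<^sup>2 * d + 1 < (2 * a) ^ 3" by (simp add: power2_eq_square power3_eq_cube mult_ac)
next
  fix m :: nat assume m: "m > 0"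
  have "card {a \<in> {d..Y}. m dvd 4 * a\<^sup>2 * d + 1} \<le> card {a \<in> {1..Y}. m dvd 4 * a\<^sup>2 * d + 1}"
    using assms by (intro card_mono) auto
  also have "\<dots> \<le> 2 ^ omega m * (Y div m + 1)" by (rule card_quadratic_roots_le[OF m])
  finally show "card {a \<in> {d..Y}. m dvd 4 * a\<^sup>2 * d + 1} \<le> 2 ^ omega m * (Y div m + 1)" .
qed (use assms in auto)

section \<open>Summation over triples with bounded product\<close>

definition bounded_triples :: "nat \<Rightarrow> (nat \<times> nat \<times> nat) set" where
  "bounded_triples N = {(a, c, d). a > 0 \<and> c > 0 \<and> d > 0 \<and> a * c * d \<le> N}"

lemma bounded_triples_le:
  assumes "(a, c, d) \<in> bounded_triples N"
  shows "a \<le> N" "c \<le> N" "d \<le> N"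
proof -
  have pos: "a * c * d > 0" and le: "a * c * d \<le> N" using assms by (auto simp: bounded_triples_def)
  have "x \<le> N" if "x dvd a * c * d" for x
    using dvd_imp_le[OF that pos] le by (rule order_trans)
  then show "a \<le> N" "c \<le> N" "d \<le> N" by simp_all
qed

lemma finite_bounded_triples: "finite (bounded_triples N)"
  by (rule finite_subset[of _ "{..N} \<times> {..N} \<times> {..N}"]) (auto dest: bounded_triples_le)

text \<open>Dropping the rounding leaves a product of two harmonic sums: the outer variables cost
  two logarithms.\<close>

lemma sum_div_le_harmonic:
  assumes N: "N > 0" and K: "K \<ge> 0"
    and F: "\<And>u v. u \<in> {1..N} \<Longrightarrow> v \<in> {1..N} \<Longrightarrow> F u v \<le> K * real (N div (u * v))"
  shows "(\<Sum>u=1..N. \<Sum>v=1..N. F u v) \<le> K * real N * (1 + ln (real N))\<^sup>2"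
proof -
  have "(\<Sum>u=1..N. \<Sum>v=1..N. F u v) \<le> (\<Sum>u=1..N. \<Sum>v=1..N. K * real N * (1 / real u * (1 / real v)))"
  proof (intro sum_mono)
    fix u v assume uv: "u \<in> {1..N}" "v \<in> {1..N}"
    have "K * real (N div (u * v)) \<le> K * (real N / real (u * v))"
      using K by (intro mult_left_mono of_nat_div_le_of_nat)
    then show "F u v \<le> K * real N * (1 / real u * (1 / real v))" using F[OF uv] by simp
  qed
  also have "\<dots> = K * real N * ((\<Sum>u=1..N. 1 / real u) * (\<Sum>v=1..N. 1 / real v))"
    unfolding sum_product by (simp only: sum_distrib_left)
  also have "\<dots> \<le> K * real N * ((1 + ln (real N)) * (1 + ln (real N)))"
    using K harmonic_le_ln[OF N] N by (intro mult_left_mono mult_mono sum_nonneg) auto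
  finally show ?thesis by (simp add: power2_eq_square)
qed

text \<open>The larger of \<open>a\<close> and \<open>d\<close> becomes the innermost variable, so
  the linear or the quadratic bound applies. The two cases give 192 = 2 * 96.\<close>

lemma sum_tau_bounded_triples_le:
  assumes N: "N > 0"
  shows "(\<Sum>(a, c, d)\<in>bounded_triples N. real (tau (4 * a\<^sup>2 * d + 1)))
    \<le> 192 * real N * (1 + ln (real N))\<^sup>2 * (1 + ln (2 * real N)) ^ 3"
proof -
  define g where "g a d = real (tau (4 * a\<^sup>2 * d + 1))" for a d
  define K where "K = 96 * (1 + ln (2 * real N)) ^ 3"
  have K: "K \<ge> 0" using N by (simp add: K_def)
  let ?A = "SIGMA a:{1..N}. SIGMA c:{1..N}. {a..N div (a * c)}"
  let ?D = "SIGMA d:{1..N}. SIGMA c:{1..N}. {d..N div (d * c)}"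
  \<comment> \<open>\<open>?D\<close> lists its triples as (d, c, a). Triples with a = d occur in
    both pieces, which is harmless for nonnegative summands.\<close>
  have sub: "bounded_triples N \<subseteq> ?A \<union> (\<lambda>(d, c, a). (a, c, d)) ` ?D"
  proof
    fix t assume "t \<in> bounded_triples N"
    moreover obtain a c d where acd: "t = (a, c, d)" by (cases t)
    ultimately have t: "(a, c, d) \<in> bounded_triples N" by simp
    then have pos: "a > 0" "c > 0" "d > 0" "a * c * d \<le> N" by (auto simp: bounded_triples_def)
    then have "d \<le> N div (a * c)" "a \<le> N div (d * c)"
      by (simp_all add: less_eq_div_iff_mult_less_eq mult_ac)
    then have "(a, c, d) \<in> ?A \<or> (d, c, a) \<in> ?D" using bounded_triples_le[OF t] pos by auto
    then show "t \<in> ?A \<union> (\<lambda>(d, c, a). (a, c, d)) ` ?D"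
      unfolding acd using image_eqI[of "(a, c, d)" "\<lambda>(d, c, a). (a, c, d)" "(d, c, a)" ?D, unfolded prod.case, OF refl]
      by blast
  qed
  have fin: "finite ?A" "finite ?D" by auto
  have "(\<Sum>(a, c, d)\<in>bounded_triples N. g a d) \<le> (\<Sum>(a, c, d)\<in>?A \<union> (\<lambda>(d, c, a). (a, c, d)) ` ?D. g a d)"
    using sub fin by (intro sum_mono2) (auto simp: g_def)
  also have "\<dots> \<le> (\<Sum>(a, c, d)\<in>?A. g a d) + (\<Sum>(a, c, d)\<in>(\<lambda>(d, c, a). (a, c, d)) ` ?D. g a d)"
    using fin by (subst sum.union_inter[symmetric]) (auto simp: g_def intro!: sum_nonneg)
  also have "(\<Sum>(a, c, d)\<in>(\<lambda>(d, c, a). (a, c, d)) ` ?D. g a d) = (\<Sum>(d, c, a)\<in>?D. g a d)"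
    by (subst sum.reindex) (auto simp: inj_on_def case_prod_unfold)
  also have "(\<Sum>(d, c, a)\<in>?D. g a d) = (\<Sum>d=1..N. \<Sum>c=1..N. \<Sum>a=d..N div (d * c). g a d)"
    by (simp add: sum.Sigma)
  also have "\<dots> \<le> K * real N * (1 + ln (real N))\<^sup>2"
  proof (rule sum_div_le_harmonic[OF N K])
    fix d c assume "d \<in> {1..N}" "c \<in> {1..N}"
    then show "(\<Sum>a=d..N div (d * c). g a d) \<le> K * real (N div (d * c))"
      using sum_tau_quadratic_le[of d "N div (d * c)" N] by (simp add: g_def K_def mult_ac)
  qed
  also have "(\<Sum>(a, c, d)\<in>?A. g a d) = (\<Sum>a=1..N. \<Sum>c=1..N. \<Sum>d=a..N div (a * c). g a d)"
    by (simp add: sum.Sigma)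
  also have "\<dots> \<le> K * real N * (1 + ln (real N))\<^sup>2"
  proof (rule sum_div_le_harmonic[OF N K])
    fix a c assume "a \<in> {1..N}" "c \<in> {1..N}"
    then show "(\<Sum>d=a..N div (a * c). g a d) \<le> K * real (N div (a * c))"
      using sum_tau_linear_le[of a "N div (a * c)" N] by (simp add: g_def K_def mult_ac)
  qed
  finally show ?thesis by (simp add: g_def K_def mult_ac)
qed

section \<open>Parametrization of the solutions\<close>

text \<open>Write n1 = p k, n2 = a h, n3 = b h with h the gcd. With denominators cleared,
  \<open>ab\<close> divides \<open>k\<close> with quotient \<open>d\<close>, then \<open>d\<close>
  divides \<open>h\<close> with quotient \<open>c\<close>, then \<open>c\<close> divides
  \<open>a + b\<close> with quotient \<open>e\<close>; \<open>p\<close> is coprime to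
  \<open>a\<close>, \<open>b\<close> and \<open>c\<close>.\<close>

lemma type_I_parametrization:
  assumes p: "prime p" and n: "n1 > 0" "n2 > 0" "n3 > 0"
    and eq: "4 / real p = 1 / real n1 + 1 / real n2 + 1 / real n3"
    and dv: "p dvd n1" "\<not> p dvd n2" "\<not> p dvd n3" and le: "n2 \<le> n3"
  obtains a b c d e where "a > 0" "c > 0" "d > 0" "e > 0"
    "n1 = a * b * d * p" "n2 = a * c * d" "n3 = b * c * d"
    "a + b = c * e" "4 * a * b * d = p * e + 1" "a * c * d \<le> p"
proof -
  have p0: "p > 0" using p prime_gt_0_nat by blast
  obtain k where k: "n1 = p * k" using dv(1) by auto
  define h where "h = gcd n2 n3"
  have h: "h > 0" using n by (simp add: h_def)
  obtain a b where ab: "n2 = a * h" "n3 = b * h" "coprime a b"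
    using gcd_coprime_exists[of n2 n3] h unfolding h_def by auto
  have k0: "k > 0" using n k by (auto intro!: Nat.gr0I)
  have a0: "a > 0" and b0: "b > 0" using n ab by (auto intro!: Nat.gr0I)
  have "real (4 * n1 * n2 * n3) = real (p * (n2 * n3 + n1 * n3 + n1 * n2))"
    using eq p0 n by (simp add: field_simps)
  then have "4 * n1 * n2 * n3 = p * (n2 * n3 + n1 * n3 + n1 * n2)"
    by (simp only: of_nat_eq_iff)
  then have "(p * h * h) * (4 * k * (a * b)) = (p * h) * (a * b * h + p * k * (a + b))"
    unfolding k ab by (simp add: algebra_simps)
  then have "(p * h) * (4 * k * (a * b) * h) = (p * h) * (a * b * h + p * k * (a + b))"
    by (simp add: mult_ac)
  then have E1: "4 * k * (a * b) * h = a * b * h + p * k * (a + b)"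
    using p0 h by (simp only: mult_cancel1) auto
  have "a * b dvd a * b * h + p * k * (a + b)" unfolding E1[symmetric] by simp
  then have "a * b dvd p * k * (a + b)" by (simp only: dvd_add_right_iff dvd_triv_left)
  moreover have "coprime a (a + b)" "coprime b (a + b)"
    using ab(3) gcd_add1[of a b] gcd_add1[of b a]
    by (simp_all only: coprime_iff_gcd_eq_1 gcd.commute[of _ "a + b"] gcd.commute[of b a] add.commute[of b a])
  then have "coprime (a * b) (a + b)" by simp
  moreover have "\<not> p dvd a" "\<not> p dvd b" using dv ab by auto
  then have "coprime (a * b) p"
    using prime_imp_coprime[OF p, of a] prime_imp_coprime[OF p, of b] by (simp add: coprime_commute)
  ultimately have "a * b dvd k"
    by (simp add: coprime_dvd_mult_left_iff coprime_dvd_mult_right_iff)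
  then obtain d where d: "k = a * b * d" by auto
  have d0: "d > 0" using k0 d by (auto intro!: Nat.gr0I)
  have "(a * b) * (4 * a * b * d * h) = (a * b) * (h + p * d * (a + b))"
    using E1 unfolding d by (simp add: algebra_simps)
  then have E2: "4 * a * b * d * h = h + p * d * (a + b)" using a0 b0 by simp
  have "d dvd h + p * d * (a + b)" unfolding E2[symmetric] by simp
  then have "d dvd h" by (simp add: dvd_add_left_iff)
  then obtain c where c: "h = d * c" by auto
  have c0: "c > 0" using h c by (auto intro!: Nat.gr0I)
  have "d * (4 * a * b * d * c) = d * (c + p * (a + b))"
    using E2 unfolding c by (simp add: algebra_simps)
  then have E3: "4 * a * b * d * c = c + p * (a + b)" using d0 by simp
  have "c dvd c + p * (a + b)" unfolding E3[symmetric] by simp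
  then have "c dvd p * (a + b)" by (simp add: dvd_add_right_iff)
  moreover have "\<not> p dvd c" using dv(2) ab c by auto
  then have "coprime c p" using prime_imp_coprime[OF p, of c] by (simp add: coprime_commute)
  ultimately have "c dvd a + b" by (simp add: coprime_dvd_mult_right_iff)
  then obtain e where e: "a + b = c * e" by auto
  have e0: "e > 0" using e a0 by (auto intro!: Nat.gr0I)
  have "c * (4 * a * b * d) = c * (p * e + 1)" using E3 unfolding e by (simp add: algebra_simps)
  then have E4: "4 * a * b * d = p * e + 1" using c0 by (simp only: mult_cancel1) auto
  \<comment> \<open>The ordering yields c at most 2b, so both terms on the right of
    \<open>E3\<close> are at most 2bp; dividing by 4b bounds \<open>a * c * d\<close>.\<close>
  have "a \<le> b" using le ab h by simp
  moreover have "c \<le> a + b" using e e0 by simp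
  ultimately have "c \<le> 2 * b" by linarith
  moreover have "p * (a + b) \<le> p * (2 * b)" using \<open>a \<le> b\<close> by (intro mult_le_mono) auto
  moreover have "2 * b \<le> p * (2 * b)" using p0 by simp
  ultimately have "4 * a * b * d * c \<le> p * (2 * b) + p * (2 * b)" unfolding E3 by linarith
  then have "(4 * b) * (a * c * d) \<le> (4 * b) * p" by (simp add: algebra_simps)
  then have "a * c * d \<le> p" using b0 by simp
  then show ?thesis
    using that[of a c d e b] a0 c0 d0 e0 k ab d c e E4 by (simp add: mult_ac)
qed

section \<open>Counting the solutions\<close>

definition sorted_solutions :: "nat \<Rightarrow> (nat \<times> nat \<times> nat) set" where
  "sorted_solutions p = {(n1, n2, n3). (n1, n2, n3) \<in> ES_triples p \<and>
     p dvd n1 \<and> \<not> p dvd n2 \<and> \<not> p dvd n3 \<and> n2 \<le> n3}"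

lemma finite_sorted_solutions: "p > 0 \<Longrightarrow> finite (sorted_solutions p)"
  by (rule finite_subset[OF _ finite_ES_triples]) (auto simp: sorted_solutions_def)

lemma f1_le_sorted_solutions:
  assumes p: "p > 0"
  shows "f1 p \<le> 6 * card (sorted_solutions p)"
proof -
  define S where "S = sorted_solutions p"
  have fin: "finite S" using finite_sorted_solutions[OF p] by (simp add: S_def)
  \<comment> \<open>The length of a list bounds the number of permutations without a proof that the
    six functions differ.\<close>
  define perms :: "(nat \<times> nat \<times> nat \<Rightarrow> nat \<times> nat \<times> nat) list" where
    "perms = [\<lambda>(x, y, z). (x, y, z), \<lambda>(x, y, z). (x, z, y), \<lambda>(x, y, z). (y, x, z),
          \<lambda>(x, y, z). (z, x, y), \<lambda>(x, y, z). (y, z, x), \<lambda>(x, y, z). (z, y, x)]"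
  have S: "(x, y, z) \<in> S \<longleftrightarrow> x > 0 \<and> y > 0 \<and> z > 0 \<and>
     4 / real p = 1 / real x + 1 / real y + 1 / real z \<and> p dvd x \<and> \<not> p dvd y \<and> \<not> p dvd z \<and> y \<le> z" for x y z
    by (auto simp: S_def sorted_solutions_def ES_triples_def)
  have "{(n1, n2, n3). (n1, n2, n3) \<in> ES_triples p \<and>
     (p dvd n1 \<and> \<not> p dvd n2 \<and> \<not> p dvd n3 \<or>
      \<not> p dvd n1 \<and> p dvd n2 \<and> \<not> p dvd n3 \<or>
      \<not> p dvd n1 \<and> \<not> p dvd n2 \<and> p dvd n3)} \<subseteq> (\<Union>\<sigma>\<in>set perms. \<sigma> ` S)"
  proof (clarify)
    fix x y z assume "(x, y, z) \<in> ES_triples p" and dv: "p dvd x \<and> \<not> p dvd y \<and> \<not> p dvd z \<or>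
      \<not> p dvd x \<and> p dvd y \<and> \<not> p dvd z \<or> \<not> p dvd x \<and> \<not> p dvd y \<and> p dvd z"
    then have t: "x > 0" "y > 0" "z > 0" "4 / real p = 1 / real x + 1 / real y + 1 / real z"
      by (auto simp: ES_triples_def)
    consider "(x, y, z) \<in> S" | "(x, z, y) \<in> S" | "(y, x, z) \<in> S" | "(y, z, x) \<in> S" | "(z, x, y) \<in> S" | "(z, y, x) \<in> S"
      unfolding S using t dv by (smt (verit) nle_le)
    then show "(x, y, z) \<in> (\<Union>\<sigma>\<in>set perms. \<sigma> ` S)"
      unfolding perms_def by cases (auto intro: rev_image_eqI)
  qed
  then have "f1 p \<le> card (\<Union>\<sigma>\<in>set perms. \<sigma> ` S)"
    unfolding f1_def using fin by (intro card_mono) auto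
  also have "\<dots> \<le> (\<Sum>\<sigma>\<in>set perms. card (\<sigma> ` S))" by (rule card_UN_le) simp
  also have "\<dots> \<le> (\<Sum>\<sigma>\<in>set perms. card S)" by (intro sum_mono card_image_le fin)
  also have "\<dots> \<le> 6 * card S" using card_length[of perms] by (simp add: perms_def)
  finally show ?thesis by (simp add: S_def)
qed

text \<open>Since \<open>b\<close> and \<open>p\<close> are recovered from (a, c, d, e), one count
  of tuples covers all primes at once.\<close>

lemma sum_card_sorted_solutions_le:
  assumes P: "finite P" "\<And>p. p \<in> P \<Longrightarrow> prime p \<and> p \<le> N"
  shows "(\<Sum>p\<in>P. card (sorted_solutions p)) \<le> (\<Sum>(a, c, d)\<in>bounded_triples N. tau (4 * a\<^sup>2 * d + 1))"
proof -
  define K where "K = (SIGMA t:bounded_triples N. case t of (a, c, d) \<Rightarrow> {e. e dvd 4 * a\<^sup>2 * d + 1})"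
  \<comment> \<open>On tuples that come from no solution, truncated subtraction and division may
    give meaningless values; only the inclusion in the image of \<open>g\<close> matters.\<close>
  define g :: "(nat \<times> nat \<times> nat) \<times> nat \<Rightarrow> nat \<times> nat \<times> nat \<times> nat" where
    "g = (\<lambda>((a, c, d), e). let b = c * e - a; p = (4 * a * b * d - 1) div e
            in (p, a * b * d * p, a * c * d, b * c * d))"
  have fin: "finite K" unfolding K_def
    by (intro finite_SigmaI finite_bounded_triples) (auto split: prod.split)
  have "(SIGMA p:P. sorted_solutions p) \<subseteq> g ` K"
  proof
    fix t assume "t \<in> (SIGMA p:P. sorted_solutions p)"
    then obtain p n1 n2 n3 where t: "t = (p, n1, n2, n3)" and pP: "p \<in> P"
      and "(n1, n2, n3) \<in> sorted_solutions p" by auto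
    then have *: "n1 > 0" "n2 > 0" "n3 > 0" "4 / real p = 1 / real n1 + 1 / real n2 + 1 / real n3"
      "p dvd n1" "\<not> p dvd n2" "\<not> p dvd n3" "n2 \<le> n3"
      unfolding sorted_solutions_def ES_triples_def by simp_all
    have p: "prime p" "p \<le> N" using P pP by auto
    obtain a b c d e where abc: "a > 0" "c > 0" "d > 0" "e > 0"
      "n1 = a * b * d * p" "n2 = a * c * d" "n3 = b * c * d"
      "a + b = c * e" "4 * a * b * d = p * e + 1" "a * c * d \<le> p"
      by (rule type_I_parametrization[OF p(1) *])
    \<comment> \<open>Adding \<open>p * e\<close> turns the value into 4ad(a + b) = 4adce, a
      multiple of \<open>e\<close>.\<close>
    have "(4 * a\<^sup>2 * d + 1) + p * e = 4 * a * d * (a + b)"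
      using abc(9) by (simp add: algebra_simps power2_eq_square)
    then have "e dvd (4 * a\<^sup>2 * d + 1) + p * e" unfolding abc(8) by simp
    then have "e dvd 4 * a\<^sup>2 * d + 1" by (simp only: dvd_add_left_iff dvd_triv_right)
    then have "((a, c, d), e) \<in> K" using abc p by (simp add: K_def bounded_triples_def)
    moreover have "c * e - a = b" using abc(8) by simp
    then have "g ((a, c, d), e) = t"
      using abc by (simp add: g_def t)
    ultimately show "t \<in> g ` K" by (metis image_eqI)
  qed
  then have "card (SIGMA p:P. sorted_solutions p) \<le> card K"
    using fin by (rule surj_card_le[rotated])
  moreover have "card (SIGMA p:P. sorted_solutions p) = (\<Sum>p\<in>P. card (sorted_solutions p))"
    using P by (intro card_SigmaI ballI finite_sorted_solutions) (auto simp: prime_gt_0_nat)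
  moreover have "card K = (\<Sum>t\<in>bounded_triples N. card (case t of (a, c, d) \<Rightarrow> {e. e dvd 4 * a\<^sup>2 * d + 1}))"
    unfolding K_def by (intro card_SigmaI finite_bounded_triples) (auto split: prod.split)
  moreover have "\<dots> = (\<Sum>(a, c, d)\<in>bounded_triples N. tau (4 * a\<^sup>2 * d + 1))"
    by (intro sum.cong refl) (auto simp: tau_def)
  ultimately show ?thesis by simp
qed

lemma sum_f1_le:
  assumes P: "finite P" "\<And>p. p \<in> P \<Longrightarrow> prime p \<and> p \<le> N" and N: "N > 0"
  shows "(\<Sum>p\<in>P. real (f1 p)) \<le> 1152 * real N * (1 + ln (real N))\<^sup>2 * (1 + ln (2 * real N)) ^ 3"
proof -
  have "(\<Sum>p\<in>P. f1 p) \<le> (\<Sum>p\<in>P. 6 * card (sorted_solutions p))"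
    using P by (intro sum_mono f1_le_sorted_solutions) (auto simp: prime_gt_0_nat)
  also have "\<dots> = 6 * (\<Sum>p\<in>P. card (sorted_solutions p))" by (simp only: sum_distrib_left)
  also have "\<dots> \<le> 6 * (\<Sum>(a, c, d)\<in>bounded_triples N. tau (4 * a\<^sup>2 * d + 1))"
    using sum_card_sorted_solutions_le[OF P] by simp
  finally have "real (\<Sum>p\<in>P. f1 p) \<le> real (6 * (\<Sum>(a, c, d)\<in>bounded_triples N. tau (4 * a\<^sup>2 * d + 1)))"
    by (simp only: of_nat_le_iff)
  then have "(\<Sum>p\<in>P. real (f1 p)) \<le> 6 * (\<Sum>(a, c, d)\<in>bounded_triples N. real (tau (4 * a\<^sup>2 * d + 1)))"
    by (simp only: of_nat_sum of_nat_mult of_nat_numeral case_prod_unfold)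
  also have "\<dots> \<le> 6 * (192 * real N * (1 + ln (real N))\<^sup>2 * (1 + ln (2 * real N)) ^ 3)"
    by (intro mult_left_mono sum_tau_bounded_triples_le N) simp
  finally show ?thesis by simp
qed

theorem mainTheorem1:
  shows "\<exists>C x0 :: real. C > 0 \<and>
    (\<forall>x :: real. x \<ge> x0 \<longrightarrow>
      (\<Sum>p\<in>{p :: nat. prime p \<and> real p < x}. real (f1 p)) \<le> C * x * (ln x) ^ 5 * (ln (ln x)) ^ 2)"
proof (intro exI conjI allI impI)
  \<comment> \<open>This threshold makes \<open>ln x\<close> at least e, hence
    \<open>ln (ln x)\<close> at least 1.\<close>
  fix x :: real assume x: "x \<ge> exp (exp 1)"
  define N where "N = nat \<lfloor>x\<rfloor>"
  define L where "L = ln x"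
  have "exp (exp 1) \<ge> (1 :: real)" by simp
  then have x1: "x \<ge> 1" using x by linarith
  have L: "L \<ge> exp 1" using x x1 by (simp add: L_def ln_ge_iff)
  moreover have "exp 1 \<ge> (1 :: real)" by simp
  ultimately have L1: "L \<ge> 1" by linarith
  have lnL: "ln L \<ge> 1" using L L1 by (simp add: ln_ge_iff)
  have N: "N > 0" "real N \<le> x" using x1 by (auto simp: N_def)
  have lnN: "0 \<le> ln (real N)" "ln (real N) \<le> L" using N x1 by (auto simp: L_def)
  have ln2: "ln (2 :: real) \<le> 1" using ln_le_minus_one[of 2] by simp
  have ln2N: "0 \<le> ln (2 * real N)" "ln (2 * real N) \<le> 1 + L" using N lnN ln2 by (auto simp: ln_mult)
  let ?P = "{p :: nat. prime p \<and> real p < x}"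
  have le: "p \<le> N" if "real p < x" for p using that by (simp add: N_def le_nat_floor)
  then have "?P \<subseteq> {..N}" by auto
  then have fin: "finite ?P" using finite_subset by blast
  have "(\<Sum>p\<in>?P. real (f1 p)) \<le> 1152 * real N * (1 + ln (real N))\<^sup>2 * (1 + ln (2 * real N)) ^ 3"
    using le N by (intro sum_f1_le fin) auto
  \<comment> \<open>With \<open>L\<close> at least 1, 1 + L is at most 2L and 2 + L at most 3L; the
    constant becomes 1152 * 4 * 27 = 124416.\<close>
  also have "\<dots> \<le> 1152 * x * (2 * L)\<^sup>2 * (3 * L) ^ 3"
    using N lnN ln2N L1 x1 by (intro mult_mono power_mono) auto
  also have "\<dots> = 124416 * x * L ^ 5 * 1" by (simp add: eval_nat_numeral)
  also have "\<dots> \<le> 124416 * x * L ^ 5 * (ln L)\<^sup>2"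
    using x1 L1 lnL by (intro mult_left_mono one_le_power) auto
  finally show "(\<Sum>p\<in>?P. real (f1 p)) \<le> 124416 * x * (ln x) ^ 5 * (ln (ln x)) ^ 2"
    by (simp add: L_def)
qed simp

end
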